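(* A finite group $G$ satisfies the relation $$|G|-1\equiv 0 \pmod{|\mathrm{Aut}(G)|}$$ if and only if $G$ is cyclic and its order $|G|$ is a prime or a Lehmer number.
   Context: $\mathrm{Aut}(G)$ denotes the automorphism group of $G$, and $\varphi$ denotes Euler's totient function: $\varphi(n)$ is the number of positive integers less than or equal to $n$ that are coprime to $n$. A Lehmer number is a counterexample to Lehmer's totient problem, that is, a composite positive integer $n$ such that $\varphi(n)\mid n-1$ (no such number is known).
   Formalization: The group G is assumed to be nontrivial, because for the trivial group the congruence holds and G is cyclic, but its order 1 is neither a prime nor a Lehmer number (which must be composite). *)

theory Defs
  imports "HOL-Algebra.Algebra" "HOL-Number_Theory.Number_Theory"
begin

text \<open>\<open>HOL-Algebra\<close> has a ring-theoretic constant \<^emph>\<open>prime\<close> of its own, so the number-theoretic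
  one is written with its qualifier. The number 1 is neither prime nor composite.\<close>

definition composite :: "nat \<Rightarrow> bool"
  where "composite n \<longleftrightarrow> n > 1 \<and> \<not> Factorial_Ring.prime n"

definition Lehmer_number :: "nat \<Rightarrow> bool"
  where "Lehmer_number n \<longleftrightarrow> composite n \<and> totient n dvd n - 1"

end

theory Submission
  imports Defs
begin

text \<open>If \<open>|Aut G|\<close> divides \<open>|G| - 1\<close>, it is coprime to \<open>|G|\<close>, so every automorphism whose order divides
  \<open>|G|\<close> is the identity. Applied to conjugations, this makes \<open>G\<close> abelian. Applied to \<open>x \<mapsto> x \<otimes> f x\<close> for
  an endomorphism \<open>f\<close> with \<open>f \<circ> f\<close> trivial, it makes \<open>f\<close> trivial. If \<open>p\<^sup>2\<close> divided \<open>|G|\<close>, a subgroup \<open>M\<close> of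
  index \<open>p\<close> would contain an element \<open>z\<close> of order \<open>p\<close>, and \<open>G \<rightarrow> G / M \<cong> \<langle>z\<rangle> \<subseteq> M\<close> would be a nontrivial
  such \<open>f\<close>. So \<open>|G|\<close> is squarefree and \<open>G\<close> is cyclic, with \<open>|Aut G| = \<phi>(|G|)\<close>.\<close>

section \<open>Automorphisms of a finite group\<close>

lemma mem_auto_iff:
  assumes "finite (carrier G)"
  shows "h \<in> auto G \<longleftrightarrow> h \<in> hom G G \<and> h \<in> extensional (carrier G) \<and> inj_on h (carrier G)"
proof -
  \<comment> \<open>Finiteness makes an injective endomorphism surjective, so bijectivity never has
    to be checked separately.\<close>
  have "h ` carrier G = carrier G" if "h \<in> hom G G" "inj_on h (carrier G)"
    using that assms by (intro endo_inj_surj) (auto simp: hom_def)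
  then show ?thesis
    by (auto simp: auto_def Bij_def bij_betw_def)
qed

lemma mult_AutoGroup:
  "\<lbrakk>f \<in> auto G; h \<in> auto G\<rbrakk> \<Longrightarrow> f \<otimes>\<^bsub>AutoGroup G\<^esub> h = compose (carrier G) f h"
  by (auto simp: AutoGroup_def BijGroup_def auto_def)

lemma one_AutoGroup: "\<one>\<^bsub>AutoGroup G\<^esub> = (\<lambda>x\<in>carrier G. x)"
  by (simp add: AutoGroup_def BijGroup_def)

lemma carrier_AutoGroup: "carrier (AutoGroup G) = auto G"
  by (simp add: AutoGroup_def)

section \<open>Elements of prime order and conjugation\<close>

context group
begin

text \<open>The order of \<open>x\<close> divides both \<open>n\<close> and the group order. This is
  used in \<open>AutoGroup G\<close>, with \<open>n\<close> the order of \<open>G\<close>, and in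
  \<open>G\<close> itself, to see that power maps are injective.\<close>

lemma pow_coprime_order_imp_one:
  assumes "x \<in> carrier G" "x [^] n = \<one>" "coprime (Coset.order G) n"
  shows "x = \<one>"
proof -
  have "ord x dvd n" "ord x dvd Coset.order G"
    using assms pow_eq_id ord_dvd_group_order by auto
  then have "ord x = 1"
    using assms(3) by (metis coprime_common_divisor_nat nat_dvd_1_iff_1)
  then show ?thesis using assms(1) ord_eq_1 by blast
qed

lemma subgroup_pow_closed:
  "\<lbrakk>subgroup H G; y \<in> H\<rbrakk> \<Longrightarrow> y [^] (k::nat) \<in> H"
  by (induction k) (simp_all add: subgroup.one_closed subgroup.m_closed)

lemma exists_prime_order_element:
  assumes "finite (carrier G)" "Factorial_Ring.prime p" "p dvd Coset.order G"
  obtains z where "z \<in> carrier G" "z \<noteq> \<one>" "z [^] p = \<one>"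
proof -
  \<comment> \<open>Exponent 1 suffices even if \<open>p\<close> divides \<open>m\<close>: Sylow's
    theorem provides a subgroup of order \<open>p\<close>, and Lagrange gives
    \<open>z [^] p = \<one>\<close> in it.\<close>
  from assms(3) obtain m where "Coset.order G = p ^ 1 * m" by (auto elim: dvdE)
  then obtain H where H: "subgroup H G" "card H = p"
    using sylow_thm[OF assms(2) is_group _ assms(1), of 1 m] by auto
  have "p > 1" using assms(2) by (rule prime_gt_1_nat)
  have "\<exists>z\<in>H. z \<noteq> \<one>"
  proof (rule ccontr)
    assume "\<not> ?thesis"
    then have "H \<subseteq> {\<one>}" by blast
    then have "card H \<le> 1" using card_mono[of "{\<one>}" H] by simp
    then show False using H \<open>p > 1\<close> by simp
  qed
  then obtain z where z: "z \<in> H" "z \<noteq> \<one>" by blast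
  interpret H: group "G\<lparr>carrier := H\<rparr>" by (rule subgroup.subgroup_is_group[OF H(1) is_group])
  have "z [^]\<^bsub>G\<lparr>carrier := H\<rparr>\<^esub> p = \<one>"
    using H.pow_order_eq_1[of z] z H(2) by (simp add: Coset.order_def)
  then have "z [^] p = \<one>" by (simp flip: nat_pow_consistent)
  then show ?thesis by (rule that[OF subgroup.mem_carrier[OF H(1) z(1)] z(2)])
qed

lemma conjugation_hom_AutoGroup:
  "group_hom G (AutoGroup G) (\<lambda>g. \<lambda>h\<in>carrier G. g \<otimes> h \<otimes> inv g)"
proof -
  let ?c = "\<lambda>g. \<lambda>h\<in>carrier G. g \<otimes> h \<otimes> inv g"
  have mult: "g \<otimes> (x \<otimes> y) \<otimes> inv g = (g \<otimes> x \<otimes> inv g) \<otimes> (g \<otimes> y \<otimes> inv g)"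
    if "g \<in> carrier G" "x \<in> carrier G" "y \<in> carrier G" for g x y
    using that by (simp add: inv_solve_right m_assoc) (metis inv_closed l_inv l_one m_assoc m_closed)
  have "?c g \<in> auto G" if "g \<in> carrier G" for g
    using conjugation_is_bij[OF that] that mult
    by (auto simp: auto_def Bij_def hom_def)
  then have "?c \<in> hom G (AutoGroup G)"
    using conjugation_is_hom
    by (auto simp: hom_def AutoGroup_def)
  then show ?thesis
    by (simp add: group_hom_def group_hom_axioms_def AutoGroup is_group)
qed

text \<open>Conjugation by \<open>x\<close> is the homomorphic image of \<open>x\<close>, so its
  power with exponent the order of \<open>G\<close> is trivial. Coprimality makes it the identity,
  hence \<open>x\<close> is central.\<close>

lemma coprime_AutoGroup_imp_comm:
  assumes "coprime (Coset.order (AutoGroup G)) (Coset.order G)"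
  shows "comm_group G"
proof (rule group_comm_groupI)
  fix x y assume xy: "x \<in> carrier G" "y \<in> carrier G"
  let ?c = "\<lambda>g. \<lambda>h\<in>carrier G. g \<otimes> h \<otimes> inv g"
  interpret c: group_hom G "AutoGroup G" ?c by (rule conjugation_hom_AutoGroup)
  have "?c x [^]\<^bsub>AutoGroup G\<^esub> Coset.order G = \<one>\<^bsub>AutoGroup G\<^esub>"
    using c.hom_nat_pow[OF xy(1), of "Coset.order G"] c.hom_one pow_order_eq_1[OF xy(1)] by simp
  then have "?c x = \<one>\<^bsub>AutoGroup G\<^esub>"
    using c.H.pow_coprime_order_imp_one[OF c.hom_closed[OF xy(1)] _ assms] by simp
  then have "?c x y = y" using xy by (simp add: one_AutoGroup)
  then show "x \<otimes> y = y \<otimes> x" using xy inv_solve_right' by auto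
qed

end

section \<open>Endomorphisms with trivial square\<close>

context comm_group
begin

text \<open>The automorphism \<open>x \<mapsto> x \<otimes> f x\<close> has \<open>k\<close>-th power \<open>x \<mapsto> x \<otimes> (f x)\<^sup>k\<close>, so its order divides
  that of \<open>G\<close>.\<close>

lemma square_zero_endomorphism_trivial:
  assumes fin: "finite (carrier G)"
    and cop: "coprime (Coset.order (AutoGroup G)) (Coset.order G)"
    and f: "f \<in> hom G G" and ff: "\<And>x. x \<in> carrier G \<Longrightarrow> f (f x) = \<one>"
    and x: "x \<in> carrier G"
  shows "f x = \<one>"
proof -
  interpret f: group_hom G G f by unfold_locales (rule f)
  interpret A: group "AutoGroup G" by (rule AutoGroup)
  define a where "a = (\<lambda>k::nat. \<lambda>x\<in>carrier G. x \<otimes> f x [^] k)"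
  \<comment> \<open>As \<open>f\<close> kills its own image, \<open>a k x\<close> determines
    \<open>f x\<close> and thereby \<open>x\<close>. This gives both injectivity and the law for
    composing \<open>a k\<close> with \<open>a 1\<close>.\<close>
  have fa: "f (a k x) = f x" if "x \<in> carrier G" for k x
    using that by (simp add: a_def f.hom_nat_pow ff)
  have a_auto: "a k \<in> auto G" for k
  proof -
    have "a k \<in> hom G G"
      by (auto simp: hom_def a_def nat_pow_distrib m_ac)
    moreover have "inj_on (a k) (carrier G)"
    proof (rule inj_onI)
      fix x y assume xy: "x \<in> carrier G" "y \<in> carrier G" "a k x = a k y"
      then have "f x = f y" using fa by metis
      then show "x = y" using xy by (simp add: a_def)
    qed
    ultimately show ?thesis by (simp add: mem_auto_iff[OF fin] a_def)
  qed
  have pow: "a 1 [^]\<^bsub>AutoGroup G\<^esub> k = a k" for k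
  proof (induction k)
    case 0
    show ?case by (auto simp: one_AutoGroup a_def fun_eq_iff)
  next
    case (Suc k)
    have "a k (a 1 x) = a (Suc k) x" if "x \<in> carrier G" for x
      using that fa[OF that, of 1] by (simp add: a_def m_ac)
    then have "compose (carrier G) (a k) (a 1) = a (Suc k)"
      by (auto simp: compose_def fun_eq_iff) (simp add: a_def)
    then show ?case
      using Suc mult_AutoGroup[OF a_auto a_auto, of k 1] by simp
  qed
  have "a (Coset.order G) = \<one>\<^bsub>AutoGroup G\<^esub>"
    by (auto simp: a_def one_AutoGroup fun_eq_iff pow_order_eq_1)
  then have "a 1 [^]\<^bsub>AutoGroup G\<^esub> Coset.order G = \<one>\<^bsub>AutoGroup G\<^esub>"
    by (simp only: pow)
  then have "a 1 = \<one>\<^bsub>AutoGroup G\<^esub>"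
    using A.pow_coprime_order_imp_one[OF _ _ cop] a_auto carrier_AutoGroup by blast
  then have "a 1 x = x" using x by (simp add: one_AutoGroup)
  then show ?thesis using x by (simp add: a_def)
qed

section \<open>Subgroups of prime index and squarefree order\<close>

lemma power_subgroup: "subgroup ((\<lambda>y. y [^] (n::nat)) ` carrier G) G"
proof -
  have "group_hom G G (\<lambda>y. y [^] n)"
    by unfold_locales (simp add: hom_def nat_pow_distrib)
  then show ?thesis by (rule group_hom.img_is_subgroup)
qed

text \<open>Modulo \<open>M\<close> the element \<open>x\<close> has order exactly \<open>p\<close>.
  A Bezout relation in the naturals writes \<open>x\<close> as a quotient of two elements of
  \<open>M\<close>, which avoids forming \<open>G Mod M\<close>.\<close>

lemma pow_mem_subgroup_imp_dvd:
  fixes p d :: nat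
  assumes M: "subgroup M G" and x: "x \<in> carrier G" "x \<notin> M"
    and p: "Factorial_Ring.prime p" "x [^] p \<in> M" and d: "x [^] d \<in> M"
  shows "p dvd d"
proof (rule ccontr)
  assume "\<not> p dvd d"
  have pow: "y [^] k \<in> M" if "y \<in> M" for y and k :: nat
    using M that by (rule subgroup_pow_closed)
  obtain u v where uv: "d * u = Suc (p * v)"
    using bezout_prime[OF p(1) \<open>\<not> p dvd d\<close>] by blast
  have "x [^] (d * u) = x [^] (p * v) \<otimes> x" using x by (simp add: uv)
  moreover have "x [^] (d * u) \<in> M" "x [^] (p * v) \<in> M"
    using pow[OF d] pow[OF p(2)] x by (simp_all add: nat_pow_pow)
  ultimately have "x \<in> M"
    using M x by (metis inv_closed inv_solve_left nat_pow_closed subgroup.m_closed subgroup.m_inv_closed)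
  then show False using x by simp
qed

text \<open>Index \<open>p\<close> is expressed by the normal form \<open>m \<otimes> x\<^sup>k\<close> of the elements.\<close>

lemma exists_prime_index_subgroup:
  assumes fin: "finite (carrier G)" and p: "Factorial_Ring.prime p" "p dvd Coset.order G"
  obtains M x where "subgroup M G" "x \<in> carrier G" "x \<notin> M" "x [^] p \<in> M"
    "\<And>y. y \<in> carrier G \<Longrightarrow> \<exists>m\<in>M. \<exists>k::nat. y = m \<otimes> x [^] k"
proof -
  \<comment> \<open>Modulo the subgroup \<open>P\<close> of \<open>p\<close>-th powers every element
    has order 1 or \<open>p\<close>, so a maximal proper subgroup containing \<open>P\<close> has
    index \<open>p\<close>.\<close>
  define P where "P = (\<lambda>y. y [^] p) ` carrier G"
  define S where "S = {H. subgroup H G \<and> P \<subseteq> H \<and> H \<noteq> carrier G}"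
  obtain z where z: "z \<in> carrier G" "z \<noteq> \<one>" "z [^] p = \<one>"
    using exists_prime_order_element[OF fin p] .
  \<comment> \<open>\<open>z\<close> and \<open>\<one>\<close> have the same \<open>p\<close>-th
    power; on a finite carrier a map that is not injective is not surjective, so \<open>P\<close> is
    proper.\<close>
  have "\<not> inj_on (\<lambda>y. y [^] p) (carrier G)"
    using z inj_onD[of _ _ z \<one>] by fastforce
  then have "P \<noteq> carrier G" unfolding P_def using fin eq_card_imp_inj_on by metis
  then have "P \<in> S" by (simp add: S_def P_def power_subgroup)
  moreover have "finite S"
    using fin by (rule_tac finite_subset[of _ "Pow (carrier G)"]) (auto simp: S_def dest: subgroup.subset)
  ultimately obtain M where M: "M \<in> S" "\<And>H. H \<in> S \<Longrightarrow> M \<subseteq> H \<Longrightarrow> M = H"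
    using finite_has_maximal[of S] by blast
  have sM: "subgroup M G" "P \<subseteq> M" "M \<noteq> carrier G" using M by (auto simp: S_def)
  then obtain x where x: "x \<in> carrier G" "x \<notin> M" using subgroup.subset by blast
  let ?X = "generate G {x}"
  have sX: "subgroup ?X G" using x generate_is_subgroup by simp
  have X: "?X = {x [^] k | k. k \<in> (UNIV :: nat set)}"
    using generate_pow_on_finite_carrier fin x by blast
  have sub: "subgroup (M <#> ?X) G" using mult_subgroups sM(1) sX by blast
  have MX: "M \<subseteq> M <#> ?X"
  proof
    fix m assume "m \<in> M"
    then show "m \<in> M <#> ?X"
      unfolding set_mult_def using subgroup.one_closed[OF sX] subgroup.mem_carrier[OF sM(1)]
      by (force intro: r_one[symmetric])
  qed
  \<comment> \<open>The product strictly contains \<open>M\<close>, so by maximality it is all of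
    \<open>G\<close>; this is the normal form.\<close>
  have "x \<in> M <#> ?X"
    unfolding set_mult_def using x subgroup.one_closed[OF sM(1)]
    by (force intro: l_one[symmetric] generate.incl)
  then have "M <#> ?X \<notin> S" using M(2) MX x by blast
  then have "M <#> ?X = carrier G" using sub MX sM by (auto simp: S_def)
  then have "\<exists>m\<in>M. \<exists>k::nat. y = m \<otimes> x [^] k" if "y \<in> carrier G" for y
    using that unfolding X set_mult_def by auto
  moreover have "x [^] p \<in> M" using sM x by (auto simp: P_def)
  ultimately show ?thesis using that sM(1) x by blast
qed

lemma coprime_AutoGroup_imp_squarefree:
  assumes fin: "finite (carrier G)"
    and cop: "coprime (Coset.order (AutoGroup G)) (Coset.order G)"
    and p: "Factorial_Ring.prime p"
  shows "\<not> p\<^sup>2 dvd Coset.order G"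
proof
  assume p2: "p\<^sup>2 dvd Coset.order G"
  then have pd: "p dvd Coset.order G" by (metis dvd_trans dvd_triv_left power2_eq_square)
  have p0: "p > 0" using p prime_gt_0_nat by blast
  obtain M x where M: "subgroup M G" and x: "x \<in> carrier G" "x \<notin> M" "x [^] p \<in> M"
    and rep: "\<And>y. y \<in> carrier G \<Longrightarrow> \<exists>m\<in>M. \<exists>k::nat. y = m \<otimes> x [^] k"
    using exists_prime_index_subgroup[OF fin p pd] by metis
  have mem: "m \<in> carrier G" if "m \<in> M" for m by (rule subgroup.mem_carrier[OF M that])
  have pow: "y [^] k \<in> M" if "y \<in> M" for y and k :: nat
    using M that by (rule subgroup_pow_closed)
  \<comment> \<open>Since \<open>x [^] p\<close> lies in \<open>M\<close>, exponents matter only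
    modulo \<open>p\<close>. The upper bound on the index is enough for the divisibility argument
    below.\<close>
  have "rcosets M \<subseteq> (\<lambda>k. M #> x [^] k) ` {..<p}"
  proof
    fix C assume "C \<in> rcosets M"
    then obtain y where y: "y \<in> carrier G" "C = M #> y" by (auto simp: RCOSETS_def)
    obtain m k where mk: "m \<in> M" "y = m \<otimes> x [^] (k::nat)" using rep[OF y(1)] by blast
    have "x [^] k = x [^] (p * (k div p) + k mod p)" by simp
    also have "\<dots> = (x [^] p) [^] (k div p) \<otimes> x [^] (k mod p)"
      using x by (simp only: nat_pow_mult[symmetric] nat_pow_pow)
    finally have y': "y = (m \<otimes> (x [^] p) [^] (k div p)) \<otimes> x [^] (k mod p)" (is "_ = ?m \<otimes> _")
      using mk x mem by (simp add: m_assoc)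
    have m': "?m \<in> M"
      by (rule subgroup.m_closed[OF M mk(1) pow[OF x(3)]])
    have "C = (M #> ?m) #> x [^] (k mod p)"
      using y y' mem[OF m'] x subgroup.subset[OF M] by (simp add: coset_mult_assoc)
    then have "C = M #> x [^] (k mod p)"
      using coset_join2[OF mem[OF m'] M m'] by simp
    then show "C \<in> (\<lambda>k. M #> x [^] k) ` {..<p}" using p0 by auto
  qed
  then have idx: "card (rcosets M) \<le> p"
    by (metis card_lessThan finite_lessThan surj_card_le)
  have lag: "card (rcosets M) * card M = Coset.order G" by (rule lagrange[OF M])
  have "p dvd card M"
  proof (rule ccontr)
    assume "\<not> p dvd card M"
    then have "coprime (p\<^sup>2) (card M)" using p prime_imp_coprime by simp
    then have "p\<^sup>2 dvd card (rcosets M)"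
      using p2 by (simp add: lag[symmetric] coprime_dvd_mult_left_iff)
    moreover have "card (rcosets M) > 0"
      using lag fin order_gt_0_iff_finite by (metis gr0I mult_0)
    ultimately have "p\<^sup>2 \<le> p" using idx by (meson dvd_imp_le le_trans)
    then show False using prime_gt_1_nat[OF p] by (simp add: power2_eq_square)
  qed
  then obtain z where z: "z \<in> M" "z \<noteq> \<one>" "z [^] p = \<one>"
  proof -
    interpret M: group "G\<lparr>carrier := M\<rparr>" by (rule subgroup.subgroup_is_group[OF M is_group])
    assume "p dvd card M" "\<And>z. z \<in> M \<Longrightarrow> z \<noteq> \<one> \<Longrightarrow> z [^] p = \<one> \<Longrightarrow> thesis"
    then show thesis
      using M.exists_prime_order_element[of p] p finite_subset[OF subgroup.subset[OF M] fin]
      by (auto simp: Coset.order_def simp flip: nat_pow_consistent)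
  qed
  \<comment> \<open>This is \<open>m \<otimes> x [^] k \<mapsto> z [^] k\<close>. The chosen
    exponent is harmless: \<open>same\<close> shows that it is unique modulo \<open>p\<close>, and
    \<open>zk\<close> that \<open>z [^] k\<close> depends only on that residue. Both take
    \<open>k \<le> l\<close> so that \<open>l - k\<close> is a true difference.\<close>
  define f where "f = (\<lambda>y. z [^] (SOME k::nat. \<exists>m\<in>M. y = m \<otimes> x [^] k))"
  have same: "p dvd l - k" if "m \<in> M" "m' \<in> M" "m \<otimes> x [^] k = m' \<otimes> x [^] l" "k \<le> l"
    for m m' and k l :: nat
  proof -
    have "x [^] l = x [^] (l - k) \<otimes> x [^] k" using that x by (simp add: nat_pow_mult)
    then have "m \<otimes> x [^] k = (m' \<otimes> x [^] (l - k)) \<otimes> x [^] k"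
      using that x mem by (simp add: m_assoc)
    then have "m = m' \<otimes> x [^] (l - k)" using that x mem by simp
    then have "x [^] (l - k) = inv m' \<otimes> m" using that x mem by (simp add: inv_solve_left)
    then have "x [^] (l - k) \<in> M"
      using that M by (simp add: subgroup.m_closed subgroup.m_inv_closed)
    then show ?thesis using pow_mem_subgroup_imp_dvd[OF M x(1,2) p x(3)] by blast
  qed
  have zk: "z [^] l = z [^] k" if "p dvd l - k" "k \<le> l" for k l :: nat
  proof -
    from that obtain j where "l = k + p * j" by (metis dvdE le_add_diff_inverse)
    then have "z [^] l = z [^] k \<otimes> (z [^] p) [^] j"
      using mem[OF z(1)] by (simp only: nat_pow_mult[symmetric] nat_pow_pow)
    then show ?thesis using z mem by simp
  qed
  have f_eq: "f (m \<otimes> x [^] k) = z [^] k" if "m \<in> M" for m and k :: nat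
  proof -
    define l where "l = (SOME l::nat. \<exists>m'\<in>M. m \<otimes> x [^] k = m' \<otimes> x [^] l)"
    have "\<exists>m'\<in>M. m \<otimes> x [^] k = m' \<otimes> x [^] l"
      unfolding l_def by (rule someI_ex) (use that in blast)
    then obtain m' where m': "m' \<in> M" "m \<otimes> x [^] k = m' \<otimes> x [^] l" by blast
    have "z [^] l = z [^] k"
      using same[OF that m'] same[OF m'(1) that m'(2)[symmetric]] zk by (metis nat_le_linear)
    then show ?thesis by (simp add: f_def l_def)
  qed
  have "f \<in> hom G G"
  proof (rule homI)
    fix y assume "y \<in> carrier G"
    then show "f y \<in> carrier G" using z mem by (simp add: f_def)
  next
    fix y y' assume "y \<in> carrier G" "y' \<in> carrier G"
    then obtain m k m' k' where "m \<in> M" "m' \<in> M" "y = m \<otimes> x [^] (k::nat)" "y' = m' \<otimes> x [^] (k'::nat)"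
      using rep by metis
    moreover from this have "y \<otimes> y' = (m \<otimes> m') \<otimes> x [^] (k + k')"
      using x mem by (simp add: m_ac nat_pow_mult[symmetric])
    ultimately show "f (y \<otimes> y') = f y \<otimes> f y'"
      using M z mem by (simp add: f_eq subgroup.m_closed nat_pow_mult)
  qed
  moreover have "f (f y) = \<one>" if "y \<in> carrier G" for y
  proof -
    \<comment> \<open>The powers of \<open>z\<close> lie in \<open>M\<close>, where the exponent of
      \<open>x\<close> may be taken as 0.\<close>
    have "f y \<in> M" using pow z by (simp add: f_def)
    then show ?thesis using f_eq[of "f y" 0] mem by simp
  qed
  ultimately have "f x = \<one>"
    using square_zero_endomorphism_trivial[OF fin cop] x by blast
  moreover have "f x = z" using f_eq[of \<one> 1] x z mem subgroup.one_closed[OF M] by simp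
  ultimately show False using z by simp
qed

section \<open>From squarefree order to a generator\<close>

lemma ord_mult_coprime:
  assumes x: "x \<in> carrier G" and y: "y \<in> carrier G" and cop: "coprime (ord x) (ord y)"
  shows "ord (x \<otimes> y) = ord x * ord y"
proof (rule dvd_antisym)
  show "ord (x \<otimes> y) dvd ord x * ord y" using x y by (rule abelian_ord_mul_divides)
next
  let ?k = "ord (x \<otimes> y)"
  \<comment> \<open>The exponent \<open>ord (u \<otimes> v) * ord v\<close> kills both
    \<open>u \<otimes> v\<close> and \<open>v\<close>, hence \<open>u\<close>; coprimality then
    cancels \<open>ord v\<close>.\<close>
  have *: "ord u dvd ord (u \<otimes> v)"
    if u: "u \<in> carrier G" and v: "v \<in> carrier G" and c: "coprime (ord u) (ord v)" for u v
  proof -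
    have "(u \<otimes> v) [^] (ord (u \<otimes> v) * ord v) = \<one>"
      using u v by (simp add: pow_eq_id)
    moreover have "v [^] (ord (u \<otimes> v) * ord v) = \<one>" using v by (simp add: pow_eq_id)
    ultimately have "u [^] (ord (u \<otimes> v) * ord v) = \<one>"
      using u v by (simp add: nat_pow_distrib)
    then have "ord u dvd ord (u \<otimes> v) * ord v" using u pow_eq_id by blast
    then show ?thesis using c coprime_dvd_mult_left_iff by blast
  qed
  have "ord x dvd ?k" using * x y cop by blast
  moreover have "ord y dvd ?k"
    using *[OF y x] cop x y by (simp add: m_comm coprime_commute)
  ultimately show "ord x * ord y dvd ?k" using cop divides_mult by blast
qed

text \<open>Let \<open>g\<close> have maximal order. A prime \<open>p\<close> dividing the group
  order but not \<open>ord g\<close> would allow a larger order \<open>ord g * p\<close>. So a prime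
  factor of the cofactor \<open>q\<close> also divides \<open>ord g\<close>, and its square divides
  the group order.\<close>

lemma squarefree_order_imp_generator:
  assumes fin: "finite (carrier G)"
    and sf: "\<And>p. Factorial_Ring.prime p \<Longrightarrow> \<not> p\<^sup>2 dvd Coset.order G"
  obtains g where "g \<in> carrier G" "ord g = Coset.order G"
proof -
  have "Max (ord ` carrier G) \<in> ord ` carrier G" using fin by (intro Max_in) auto
  then obtain g where g: "g \<in> carrier G" "Max (ord ` carrier G) = ord g" by auto
  then have max: "ord h \<le> ord g" if "h \<in> carrier G" for h
    using fin that by (metis Max_ge finite_imageI imageI)
  have g0: "ord g > 0" using ord_ge_1[OF fin g(1)] by simp
  have dvd: "p dvd ord g" if p: "Factorial_Ring.prime p" "p dvd Coset.order G" for p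
  proof (rule ccontr)
    assume nd: "\<not> p dvd ord g"
    obtain z where z: "z \<in> carrier G" "z \<noteq> \<one>" "z [^] p = \<one>"
      using exists_prime_order_element[OF fin p] .
    then have "ord z = p"
      using p(1) pow_eq_id ord_eq_1 by (metis prime_nat_iff)
    then have "ord (g \<otimes> z) = ord g * p"
      using ord_mult_coprime[OF g(1) z(1)] nd p(1) prime_imp_coprime coprime_commute by metis
    then show False
      using max[of "g \<otimes> z"] g z g0 prime_gt_1_nat[OF p(1)] by simp
  qed
  obtain q where q: "Coset.order G = ord g * q" using ord_dvd_group_order[OF g(1)] by (rule dvdE)
  have "q = 1"
  proof (rule ccontr)
    assume "q \<noteq> 1"
    then obtain p where p: "Factorial_Ring.prime p" "p dvd q" using prime_factor_nat by blast
    then have "p * p dvd ord g * q" using dvd[of p] q by (simp add: mult_dvd_mono)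
    then show False using sf[OF p(1)] q by (simp add: power2_eq_square)
  qed
  then show ?thesis using that g q by simp
qed

end

section \<open>Automorphisms of finite cyclic groups\<close>

context group
begin

lemma generator_imp_carrier:
  assumes fin: "finite (carrier G)" and g: "g \<in> carrier G" "ord g = Coset.order G"
  shows "carrier G = {g [^] k | k. k \<in> (UNIV :: nat set)}"
proof -
  have "generate G {g} = carrier G"
    using g fin generate_incl[of "{g}"] generate_pow_card[of g]
    by (intro card_subset_eq) (auto simp: Coset.order_def)
  then show ?thesis using generate_pow_on_finite_carrier[OF fin g(1)] by simp
qed

lemma cyclic_group_iff_generator:
  assumes fin: "finite (carrier G)"
  shows "cyclic_group G \<longleftrightarrow> (\<exists>g\<in>carrier G. ord g = Coset.order G)"
proof
  assume "cyclic_group G"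
  then show "\<exists>g\<in>carrier G. ord g = Coset.order G"
    unfolding cyclic_group_def using cyclic_order_is_ord by metis
next
  assume "\<exists>g\<in>carrier G. ord g = Coset.order G"
  then obtain g where g: "g \<in> carrier G" "ord g = Coset.order G" by blast
  have "carrier G \<subseteq> range (\<lambda>n::int. g [^] n)"
  proof
    fix y assume "y \<in> carrier G"
    then obtain k :: nat where "y = g [^] k" using generator_imp_carrier[OF fin g] by blast
    then have "y = g [^] int k" by (simp add: int_pow_int)
    then show "y \<in> range (\<lambda>n::int. g [^] n)" by blast
  qed
  then show "cyclic_group G" using g by (auto simp: cyclic_group)
qed

text \<open>The automorphisms are exactly the power maps with exponent coprime to the group order,
  one for each totative.\<close>

lemma order_AutoGroup_cyclic:
  assumes fin: "finite (carrier G)" and cyc: "cyclic_group G"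
  shows "Coset.order (AutoGroup G) = totient (Coset.order G)"
proof -
  interpret comm_group G using cyclic_imp_abelian_group[OF cyc] .
  let ?n = "Coset.order G"
  have n0: "?n > 0" using fin order_gt_0_iff_finite by blast
  obtain g where g: "g \<in> carrier G" "ord g = ?n"
    using cyc cyclic_group_iff_generator[OF fin] by blast
  have eq_iff: "g [^] k = g [^] l \<longleftrightarrow> [k = l] (mod ?n)" for k l :: nat
    using int_pow_eq[OF g(1), of "int k" "int l"] g(2)
    by (simp add: int_pow_int cong_iff_dvd_diff dvd_diff_commute flip: cong_int_iff)
  let ?\<phi> = "\<lambda>k::nat. \<lambda>y\<in>carrier G. y [^] k"
  have "bij_betw ?\<phi> (totatives ?n) (auto G)"
  proof (rule bij_betw_imageI)
    show "inj_on ?\<phi> (totatives ?n)"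
    proof (rule inj_onI)
      fix k l assume kl: "k \<in> totatives ?n" "l \<in> totatives ?n" "?\<phi> k = ?\<phi> l"
      from kl(3) have "?\<phi> k g = ?\<phi> l g" by simp
      then have c: "[k = l] (mod ?n)" using g eq_iff by simp
      have "0 < k" "k \<le> ?n" "0 < l" "l \<le> ?n" using kl by (auto simp: in_totatives_iff)
      \<comment> \<open>Totatives range over 1 to \<open>?n\<close>; the shift moves them to 0 to
        \<open>?n - 1\<close>, where congruent numbers are equal.\<close>
      moreover have "[k - 1 = l - 1] (mod ?n)" if "0 < k" "0 < l"
        using c that cong_add_rcancel_nat[of "k - 1" 1 "l - 1" ?n] by simp
      ultimately have "k - 1 = l - 1" by (intro cong_less_modulus_unique_nat) auto
      then show "k = l" using \<open>0 < k\<close> \<open>0 < l\<close> by simp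
    qed
    show "?\<phi> ` totatives ?n = auto G"
    proof (intro equalityI subsetI)
      fix h assume "h \<in> ?\<phi> ` totatives ?n"
      then obtain k where k: "k \<in> totatives ?n" "h = ?\<phi> k" by blast
      then have cop: "coprime ?n k" by (simp add: in_totatives_iff coprime_commute)
      have h: "h \<in> hom G G" using k by (auto simp: hom_def nat_pow_distrib)
      interpret h: group_hom G G h by unfold_locales (rule h)
      have "x = \<one>" if "x \<in> carrier G" "h x = \<one>" for x
        using pow_coprime_order_imp_one[of x k] that k cop by simp
      then have "inj_on h (carrier G)" using h.inj_on_one_iff by blast
      then show "h \<in> auto G" using h k by (simp add: mem_auto_iff[OF fin])
    next
      fix h assume hA: "h \<in> auto G"
      then have h: "h \<in> hom G G" "h \<in> extensional (carrier G)" "inj_on h (carrier G)"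
        by (auto simp: mem_auto_iff[OF fin])
      interpret h: group_hom G G h by unfold_locales (rule h)
      have gen: "\<exists>k::nat. y = g [^] k" if "y \<in> carrier G" for y
        using that generator_imp_carrier[OF fin g] by blast
      obtain k0 :: nat where k0: "h g = g [^] k0" using gen[OF h.hom_closed[OF g(1)]] by blast
      \<comment> \<open>The residue 0 is replaced by \<open>?n\<close> because totatives are
        positive; for \<open>?n = 1\<close> this yields the totative 1.\<close>
      define k where "k = (if k0 mod ?n = 0 then ?n else k0 mod ?n)"
      have k: "h g = g [^] k" "0 < k" "k \<le> ?n"
        using n0 k0 by (auto simp: k_def eq_iff cong_def mod_le_divisor)
      have hpow: "h y = y [^] k" if "y \<in> carrier G" for y
      proof -
        obtain j :: nat where "y = g [^] j" using gen[OF \<open>y \<in> carrier G\<close>] by blast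
        then show ?thesis using g k by (simp add: h.hom_nat_pow nat_pow_pow mult.commute)
      qed
      \<comment> \<open>A preimage \<open>g [^] j\<close> of the generator makes \<open>j\<close> an
        inverse of \<open>k\<close> modulo \<open>?n\<close>.\<close>
      have "h ` carrier G = carrier G" using hA by (auto simp: auto_def Bij_def bij_betw_def)
      then obtain y where y: "y \<in> carrier G" "h y = g" using g by (metis imageE)
      obtain j :: nat where "y = g [^] j" using gen[OF y(1)] by blast
      then have "g [^] (j * k) = g [^] (1::nat)" using hpow y g by (simp add: nat_pow_pow)
      then have "[k * j = 1] (mod ?n)" using eq_iff by (metis mult.commute)
      then have "coprime k ?n" using coprime_iff_invertible_nat by auto
      then have "k \<in> totatives ?n" using k by (simp add: in_totatives_iff)
      moreover have "h = ?\<phi> k" using hpow h(2) by (auto simp: extensional_def)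
      ultimately show "h \<in> ?\<phi> ` totatives ?n" by blast
    qed
  qed
  then show ?thesis
    by (simp add: Coset.order_def[of "AutoGroup G"] carrier_AutoGroup totient_def bij_betw_same_card)
qed

section \<open>Cyclicity and the congruence\<close>

lemma coprime_AutoGroup_imp_cyclic:
  assumes fin: "finite (carrier G)"
    and cop: "coprime (Coset.order (AutoGroup G)) (Coset.order G)"
  shows "cyclic_group G"
proof -
  interpret comm_group G using coprime_AutoGroup_imp_comm[OF cop] .
  show ?thesis
    using squarefree_order_imp_generator[OF fin] coprime_AutoGroup_imp_squarefree[OF fin cop]
      cyclic_group_iff_generator[OF fin] by metis
qed

end

theorem theorem1p1:
  fixes G :: "('a, 'b) monoid_scheme"
  assumes "group G"
    and "finite (carrier G)"
    and "\<not> trivial_group G"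
  shows "[int (Coset.order G) - 1 = 0] (mod int (Coset.order (AutoGroup G)))
     \<longleftrightarrow> cyclic_group G \<and> (Factorial_Ring.prime (Coset.order G) \<or> Lehmer_number (Coset.order G))"
proof -
  interpret group G by fact
  let ?n = "Coset.order G" and ?a = "Coset.order (AutoGroup G)"
  have "?n > 0" using assms(2) order_gt_0_iff_finite by blast
  \<comment> \<open>Nontriviality excludes order 1, where the congruence holds although 1 is neither
    prime nor composite.\<close>
  moreover have "?n \<noteq> 1"
    using assms(3) by (metis Coset.order_def card_1_singletonE trivial_group)
  ultimately have n1: "?n > 1" by linarith
  have cong: "[int ?n - 1 = 0] (mod int ?a) \<longleftrightarrow> ?a dvd ?n - 1"
    using n1 by (simp add: cong_0_iff of_nat_diff flip: int_dvd_int_iff)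
  have cyclic: "cyclic_group G" if "?a dvd ?n - 1"
  proof (rule coprime_AutoGroup_imp_cyclic[OF assms(2)])
    have "coprime (?n - 1) ?n" using n1 coprime_diff_one_left_nat by simp
    then show "coprime ?a ?n" using that coprime_divisors dvd_refl by blast
  qed
  \<comment> \<open>Now \<open>?a\<close> is the totient of \<open>?n\<close>. For a prime it equals
    \<open>?n - 1\<close>; for a composite \<open>?n\<close> the divisibility is Lehmer's
    condition.\<close>
  have "?a dvd ?n - 1 \<longleftrightarrow> Factorial_Ring.prime ?n \<or> Lehmer_number ?n" if "cyclic_group G"
    using order_AutoGroup_cyclic[OF assms(2) that] n1
    by (auto simp: Lehmer_number_def composite_def totient_prime)
  then show ?thesis using cong cyclic by blast
qed

end
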